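(* Let $n$ be a positive integer, and let $\mathcal A(4n)$ and $\mathcal A(2n)$ be families of partitions of $4n$ and $2n$, respectively, of a particular type $\mathcal P$. Then $$ S_{\mathcal P}(4n)\equiv 0\pmod 4 \qquad\text{and}\qquad S_{\mathcal P}(2n)\equiv 0\pmod 2. $$
   Context: A "type" $\mathcal P$ of partitions is an arbitrary class of partitions (for example ordinary partitions, partitions into distinct parts, overpartitions, coloured partitions); each partition $\lambda$ of a positive integer $m$ of type $\mathcal P$ has a finite multiset of positive integer parts with sum $m$. $\mathcal A(m)$ denotes a finite family of partitions of $m$ of type $\mathcal P$. For $\lambda\in\mathcal A(m)$, $\omega(\lambda)$ is the sum of the odd parts of $\lambda$ minus the sum of the even parts of $\lambda$ (with multiplicity), and $S_{\mathcal P}(m)=\sum_{\lambda\in\mathcal A(m)}\omega(\lambda)$. *)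

theory Defs
  imports Main "HOL-Library.Multiset" "HOL-Number_Theory.Cong"
begin

text \<open>
  A type of partitions is a set \<open>P\<close> of abstract objects together with a map \<open>parts\<close> sending each
  object to its multiset of positive parts. The map need not be injective: overpartitions or
  coloured partitions with the same underlying parts stay distinct objects.
\<close>

definition partition_type :: "'p set \<Rightarrow> ('p \<Rightarrow> nat multiset) \<Rightarrow> bool" where
  "partition_type P parts \<longleftrightarrow> (\<forall>l\<in>P. \<forall>k\<in>#parts l. 0 < k)"

definition partitions_of :: "'p set \<Rightarrow> ('p \<Rightarrow> nat multiset) \<Rightarrow> nat \<Rightarrow> 'p set" where
  "partitions_of P parts m = {l \<in> P. sum_mset (parts l) = m}"

definition partition_omega :: "('p \<Rightarrow> nat multiset) \<Rightarrow> 'p \<Rightarrow> int" where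
  "partition_omega parts l =
     (\<Sum>k\<in>#filter_mset odd (parts l). int k) - (\<Sum>k\<in>#filter_mset even (parts l). int k)"

definition partition_S :: "('p \<Rightarrow> nat multiset) \<Rightarrow> (nat \<Rightarrow> 'p set) \<Rightarrow> nat \<Rightarrow> int" where
  "partition_S parts A m = (\<Sum>l\<in>A m. partition_omega parts l)"

end

theory Submission
  imports Defs
begin

text \<open>
  Passing from the sum of all parts to \<open>\<omega>(\<lambda>)\<close> subtracts twice the sum of the even parts, a multiple
  of 4. Hence \<open>\<omega>(\<lambda>) \<equiv> m (mod 4)\<close> for every partition \<open>\<lambda>\<close> of \<open>m\<close>.
\<close>

lemma odd_minus_even_sum_cong:
  "[(\<Sum>k\<in>#filter_mset odd M. int k) - (\<Sum>k\<in>#filter_mset even M. int k) = int (sum_mset M)] (mod 4)"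
  (is "[?f M = _] (mod 4)")
proof (induction M)
  case empty
  then show ?case by simp
next
  case (add k M)
  \<comment> \<open>A new part \<open>k\<close> contributes \<open>k\<close> or \<open>- k\<close>
    according to its parity. Only an even part changes sign, and the discrepancy
    \<open>- 2 * k\<close> is then a multiple of 4.\<close>
  have "[(if odd k then int k else - int k) = int k] (mod 4)"
  proof (cases "odd k")
    case False
    then obtain j where "k = 2 * j" by (auto elim: evenE)
    then have "- int k - int k = 4 * (- int j)" by simp
    then have "4 dvd - int k - int k" by (metis dvd_triv_left)
    with False show ?thesis by (simp add: cong_iff_dvd_diff)
  qed simp
  then have "[?f M + (if odd k then int k else - int k) = int (sum_mset M) + int k] (mod 4)"
    using add.IH by (rule cong_add[rotated])
  then show ?case by (auto simp: algebra_simps)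
qed

text \<open>Divisibility holds term by term: each weight is congruent to \<open>m\<close> modulo 4,
  hence modulo any divisor \<open>d\<close> of 4, and \<open>d\<close> divides \<open>m\<close>.
  Leaving \<open>d\<close> general serves both moduli of the theorem.\<close>

lemma dvd_partition_S:
  assumes "A m \<subseteq> partitions_of P parts m" and "d dvd 4" and "d dvd int m"
  shows "d dvd partition_S parts A m"
  unfolding partition_S_def
proof (rule dvd_sum)
  fix l assume "l \<in> A m"
  then have "sum_mset (parts l) = m"
    using assms(1) by (auto simp: partitions_of_def)
  then have "[partition_omega parts l = int m] (mod 4)"
    using odd_minus_even_sum_cong[of "parts l"] by (simp add: partition_omega_def)
  then have "[partition_omega parts l = int m] (mod d)"
    using \<open>d dvd 4\<close> by (rule cong_dvd_modulus)
  with \<open>d dvd int m\<close> show "d dvd partition_omega parts l"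
    by (simp add: cong_dvd_iff)
qed

theorem corollary4p2:
  fixes P :: "'p set" and parts :: "'p \<Rightarrow> nat multiset"
    and A :: "nat \<Rightarrow> 'p set" and n :: nat
  assumes "partition_type P parts"
    and "n > 0"
    and "finite (A (4 * n))" and "A (4 * n) \<subseteq> partitions_of P parts (4 * n)"
    and "finite (A (2 * n))" and "A (2 * n) \<subseteq> partitions_of P parts (2 * n)"
  shows "[partition_S parts A (4 * n) = 0] (mod 4) \<and> [partition_S parts A (2 * n) = 0] (mod 2)"
  \<comment> \<open>For \<open>2 * n\<close> the choice is \<open>d = 2\<close>, since 4 need not
    divide \<open>2 * n\<close>.\<close>
  using dvd_partition_S[of A "4 * n" P parts 4] dvd_partition_S[of A "2 * n" P parts 2] assms(4,6)
  by (simp add: cong_0_iff)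

end
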